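(* For each $t$, let $X_t\subset\mathbb S^2$ be an arbitrary spherical $t$-design, $t\ge2$, and let $P_t\subset\mathbb R^3$ be the corresponding Steiner-normalized Minkowski polytope. Then, using the estimate $d_{\mathrm H}(P_t,B)=O(t^{-1/2})$, one has for each fixed integer $m\ge 0$ $$\mathcal V_m(P_t^\circ)=M_{3,m}+O_m(t^{-1/2})\qquad(t\to\infty).$$ More generally, if $m=m(t)$ is a sequence of nonnegative integers with $m(t)=o(\sqrt t)$, then $$\bigl\|\mathcal V_{m(t)}(P_t^\circ)-M_{3,m(t)}\bigr\|_{\mathrm{HS}}\longrightarrow0\qquad(t\to\infty).$$
   Context: $\sigma$ is the normalized (probability) surface measure on the unit sphere $\mathbb S^{2}\subset\mathbb R^3$. A finite set $X=\{x_1,\ldots,x_N\}\subset\mathbb S^{2}$ of $N$ distinct points is a spherical $t$-design if $\frac1N\sum_i p(x_i)=\int p\,d\sigma$ for every polynomial $p$ of total degree at most $t$. For $t\ge2$, the Minkowski polytope $P_X\subset\mathbb R^3$ is the full-dimensional convex polytope, unique up to translation, with exactly $N$ facets, whose outer unit normals are $x_1,\ldots,x_N$, each of area $4\pi/N$. It is Steiner-normalized: the translate is chosen so that the Steiner point $3\int_{\mathbb S^{2}}h_{P_X}(u)u\,d\sigma(u)$ is $0$, which implies $0\in\operatorname{int}P_X$. Here $h_P(u)=\max_{y\in P}\langle u,y\rangle$ and $P^\circ=\{z:\langle z,y\rangle\le1\ \forall y\in P\}$. Put $v_i=x_i/h_{P_X}(x_i)$ (the vertices of $P_X^\circ$), $\mathcal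 V_m(P_X^\circ)=\frac1N\sum_{i=1}^N v_i^{\otimes m}$ and $M_{3,m}=\int_{\mathbb S^2}u^{\otimes m}\,d\sigma(u)$; $\|\cdot\|_{\mathrm{HS}}$ is the Hilbert--Schmidt (Euclidean) norm on tensor powers, and $O_m$ is with respect to this norm. $B$ is the closed unit ball of $\mathbb R^3$ and $d_{\mathrm H}$ is Hausdorff distance. Known result that the statement relies on and that may be assumed (C. An, "Minkowski polytopes of spherical designs", arXiv:2608.11570): there is a constant $K$ such that $d_{\mathrm H}(P_X,B)\le K t^{-1/2}$ for every $t\ge2$ and every spherical $t$-design $X\subset\mathbb S^2$. *)

theory Defs
  imports "HOL-Analysis.Analysis" "HOL-Library.Landau_Symbols"
begin

text \<open>
  The normalized surface measure, as a Borel measure on the ambient space: the measure of a set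
  \<open>A\<close> is the normalized volume of the cone \<open>{r u | u \<in> A \<inter> S\<^sup>2, 0 < r < 1}\<close>. The three lemmas below
  (total mass one, concentrated on the sphere, invariant under all orthogonal maps) determine it.
\<close>

definition sphere_measure :: "(real^3) measure" where
  "sphere_measure = distr (uniform_measure lborel (ball 0 1)) borel (\<lambda>x. x /\<^sub>R norm x)"

lemma sets_sphere_measure [simp, measurable_cong]: "sets sphere_measure = sets borel"
  and space_sphere_measure [simp]: "space sphere_measure = UNIV"
  by (simp_all add: sphere_measure_def)

lemma lborel_ball_pos_finite:
  "emeasure lborel (ball (0::real^3) 1) \<noteq> 0" "emeasure lborel (ball (0::real^3) 1) \<noteq> \<infinity>"
proof -
  show "emeasure lborel (ball (0::real^3) 1) \<noteq> \<infinity>"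
    using emeasure_bounded_finite[OF bounded_ball[of "0::real^3" 1]] by simp
  have "ball (0::real^3) 1 \<notin> null_sets lborel"
  proof
    assume "ball (0::real^3) 1 \<in> null_sets lborel"
    then have "negligible (ball (0::real^3) 1)"
      using negligible_iff_null_sets null_sets_completionI by blast
    then show False
      using open_not_negligible[of "ball (0::real^3) 1"] by simp
  qed
  then show "emeasure lborel (ball (0::real^3) 1) \<noteq> 0" by auto
qed

lemma emeasure_sphere_measure_UNIV: "emeasure sphere_measure UNIV = 1"
  unfolding sphere_measure_def using lborel_ball_pos_finite
  by (subst emeasure_distr) (auto intro!: ennreal_divide_self simp: less_top)

lemma emeasure_sphere_measure_sphere: "emeasure sphere_measure (- sphere 0 1) = 0"
proof -
  let ?S = "(\<lambda>x::real^3. x /\<^sub>R norm x) -` (- sphere 0 1)"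
  have [measurable]: "(\<lambda>x::real^3. x /\<^sub>R norm x) \<in> borel_measurable borel"
    by measurable
  have S: "?S \<in> sets borel"
    using measurable_sets[of "\<lambda>x::real^3. x /\<^sub>R norm x" borel borel "- sphere 0 1"] by simp
  have sub: "ball 0 1 \<inter> ?S \<subseteq> {0}"
    by auto (metis left_inverse norm_eq_zero)
  have "emeasure lborel (ball 0 1 \<inter> ?S) \<le> emeasure lborel {0::real^3}"
    by (rule emeasure_mono[OF sub]) simp
  then have "emeasure lborel (ball 0 1 \<inter> ?S) = 0" by simp
  then show ?thesis
    using S unfolding sphere_measure_def by (subst emeasure_distr) simp_all
qed

lemma sphere_measure_invariant:
  assumes "orthogonal_transformation f"
  shows "distr sphere_measure borel f = sphere_measure"
proof -
  have lin: "linear f" and nrm: "norm (f x) = norm x" for x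
    using assms by (auto simp: orthogonal_transformation)
  have bij: "bij f" using assms by (rule orthogonal_transformation_bij)
  have inv: "orthogonal_transformation (inv f)"
    using assms by (rule orthogonal_transformation_inv)
  have [measurable]: "f \<in> borel_measurable borel"
    using lin by (intro borel_measurable_continuous_onI linear_continuous_on)
      (simp add: linear_conv_bounded_linear)
  let ?s = "\<lambda>x::real^3. x /\<^sub>R norm x"
  let ?U = "uniform_measure lborel (ball (0::real^3) 1)"
  have U: "distr ?U borel f = ?U"
  proof (rule measure_eqI)
    fix A assume "A \<in> sets (distr ?U borel f)"
    then have A[measurable]: "A \<in> sets borel" by simp
    have eq: "ball 0 1 \<inter> f -` A = inv f ` (ball 0 1 \<inter> A)" (is "?L = _ ` ?R")
    proof
      show "?L \<subseteq> inv f ` ?R"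
      proof
        fix x assume x: "x \<in> ?L"
        have "f x \<in> ?R" using x by (simp add: nrm)
        moreover have "inv f (f x) = x" using bij by (simp add: bij_is_inj)
        ultimately show "x \<in> inv f ` ?R" by (metis imageI)
      qed
      show "inv f ` ?R \<subseteq> ?L"
      proof
        fix x assume "x \<in> inv f ` ?R"
        then obtain y where y: "y \<in> ?R" "x = inv f y" by blast
        then have "f x = y" using bij by (simp add: bij_is_surj surj_f_inv_f)
        with y nrm[of x] show "x \<in> ?L" by simp
      qed
    qed
    have sL: "?L \<in> sets borel"
      using measurable_sets[OF \<open>f \<in> borel_measurable borel\<close> A] by (intro sets.Int) auto
    have sR: "?R \<in> sets borel" by auto
    have lm: "?L \<in> lmeasurable" "?R \<in> lmeasurable"
      using sL sR by (auto intro!: bounded_set_imp_lmeasurable)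
    have "measure lborel ?L = measure lborel ?R"
      using measure_orthogonal_image[OF inv, of ?R] lm eq sL sR by simp
    moreover have "emeasure lborel ?L \<noteq> \<infinity>" "emeasure lborel ?R \<noteq> \<infinity>"
      using emeasure_bounded_finite[of ?L] emeasure_bounded_finite[of ?R] by (auto simp: bounded_Int)
    ultimately have "emeasure lborel ?L = emeasure lborel ?R"
      by (simp add: emeasure_eq_ennreal_measure)
    then show "emeasure (distr ?U borel f) A = emeasure ?U A"
      using measurable_sets[OF \<open>f \<in> borel_measurable borel\<close> A]
      by (simp add: emeasure_distr)
  qed simp
  have "distr sphere_measure borel f = distr ?U borel (f \<circ> ?s)"
    unfolding sphere_measure_def by (subst distr_distr) auto
  also have "f \<circ> ?s = ?s \<circ> f"
    by (auto simp: fun_eq_iff nrm linear_scale[OF lin])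
  also have "distr ?U borel (?s \<circ> f) = distr (distr ?U borel f) borel ?s"
    by (subst distr_distr) auto
  finally show ?thesis by (simp add: U sphere_measure_def)
qed

definition polynomial_of_degree_le :: "nat \<Rightarrow> (real^3 \<Rightarrow> real) \<Rightarrow> bool" where
  "polynomial_of_degree_le t p \<longleftrightarrow>
     (\<exists>c :: (3 \<Rightarrow> nat) \<Rightarrow> real.
        p = (\<lambda>x. \<Sum>\<alpha> | (\<Sum>i\<in>UNIV. \<alpha> i) \<le> t. c \<alpha> * (\<Prod>i\<in>UNIV. (x $ i) ^ \<alpha> i)))"

lemma finite_multiindices: "finite {\<alpha> :: 3 \<Rightarrow> nat. (\<Sum>i\<in>UNIV. \<alpha> i) \<le> t}"
proof (rule finite_subset)
  show "{\<alpha> :: 3 \<Rightarrow> nat. (\<Sum>i\<in>UNIV. \<alpha> i) \<le> t} \<subseteq> UNIV \<rightarrow>\<^sub>E {..t}"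
  proof safe
    fix \<alpha> :: "3 \<Rightarrow> nat" and i assume "sum \<alpha> UNIV \<le> t"
    then show "\<alpha> i \<le> t" using member_le_sum[of i UNIV \<alpha>] by simp
  qed auto
qed (simp add: finite_PiE)

definition spherical_design :: "nat \<Rightarrow> (real^3) set \<Rightarrow> bool" where
  "spherical_design t X \<longleftrightarrow>
     finite X \<and> X \<noteq> {} \<and> X \<subseteq> sphere 0 1 \<and>
     (\<forall>p. polynomial_of_degree_le t p \<longrightarrow>
        (\<Sum>x\<in>X. p x) / real (card X) = (LINT u|sphere_measure. p u))"

definition support_function :: "(real^3) set \<Rightarrow> real^3 \<Rightarrow> real" where
  "support_function P u = (SUP y\<in>P. u \<bullet> y)"

text \<open>
  The area of a set spanning a plane: transport it to \<open>\<real>\<^sup>2\<close> by an isometric parametrization of the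
  plane and take Lebesgue measure. Such a parametrization exists, and its choice is immaterial.
\<close>

definition plane_chart :: "(real^3) set \<Rightarrow> (real^2 \<Rightarrow> real^3) \<Rightarrow> bool" where
  "plane_chart F f \<longleftrightarrow> (\<forall>p q. dist (f p) (f q) = dist p q) \<and> range f = affine hull F"

definition planar_area :: "(real^3) set \<Rightarrow> real" where
  "planar_area F = measure lebesgue ((SOME f. plane_chart F f) -` F)"

lemma plane_chart_exists:
  assumes "aff_dim F = 2"
  shows "\<exists>f. plane_chart F f"
proof -
  from assms have "F \<noteq> {}" by auto
  then obtain a where a: "a \<in> F" by auto
  let ?T = "(\<lambda>x. x - a) ` (affine hull F)"
  have T: "subspace ?T"
    using affine_diffs_subspace_subtract[OF affine_affine_hull hull_inc[OF a]] .
  have "int (dim ?T) = aff_dim ?T" using T by (simp add: aff_dim_subspace)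
  also have "\<dots> = aff_dim (affine hull F)"
    using aff_dim_translation_eq[of "-a" "affine hull F"] by simp
  finally have d: "dim (UNIV :: (real^2) set) = dim ?T" using assms by simp
  obtain f :: "real^2 \<Rightarrow> real^3" where f: "linear f" "f ` UNIV = ?T" "\<And>x. norm (f x) = norm x"
    using isometries_subspaces[OF subspace_UNIV T d] by (metis UNIV_I)
  have "plane_chart F (\<lambda>x. a + f x)"
    unfolding plane_chart_def
  proof
    show "\<forall>p q. dist (a + f p) (a + f q) = dist p q"
      using f by (simp add: dist_norm flip: linear_diff)
    have "range (\<lambda>x. a + f x) = (+) a ` range f" by auto
    then show "range (\<lambda>x. a + f x) = affine hull F"
      using f(2) by (simp add: image_image)
  qed
  then show ?thesis by blast
qed

lemma planar_area_eq:
  assumes f: "plane_chart F f" and "compact F"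
  shows "planar_area F = measure lebesgue (f -` F)"
proof -
  define g where "g = (SOME f. plane_chart F f)"
  have g: "plane_chart F g" unfolding g_def using f by (rule someI[of "plane_chart F"])
  have df: "dist (f p) (f q) = dist p q" and dg: "dist (g p) (g q) = dist p q" for p q
    using f g by (auto simp: plane_chart_def)
  have rng: "range f = range g" and sub: "F \<subseteq> range f"
    using f g by (auto simp: plane_chart_def hull_inc)
  have injf: "inj f" by (metis df dist_eq_0_iff injI)
  define h where "h = (\<lambda>p. inv f (g p))"
  have fh: "f (h p) = g p" for p
    unfolding h_def using rng by (simp add: f_inv_into_f)
  have dh: "dist (h p) (h q) = dist p q" for p q
    by (metis df dg fh)
  define L where "L = (\<lambda>p. h p - h 0)"
  have L: "orthogonal_transformation L"
    unfolding orthogonal_transformation_isometry L_def using dh by (simp add: dist_norm)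
  have im: "f -` F = (+) (h 0) ` (L ` (g -` F))"
  proof -
    have "f -` F = h ` (g -` F)"
    proof
      show "f -` F \<subseteq> h ` (g -` F)"
      proof
        fix p assume "p \<in> f -` F"
        then obtain q where "g q = f p" using rng by (metis rangeE rangeI)
        then have "h q = p" "q \<in> g -` F"
          using injf \<open>p \<in> f -` F\<close> by (auto simp: h_def)
        then show "p \<in> h ` (g -` F)" by blast
      qed
    qed (auto simp: fh)
    then show ?thesis by (simp add: L_def image_image)
  qed
  have contg: "continuous_on UNIV g"
    unfolding continuous_on_iff using dg by metis
  have "closed (g -` F)"
    using contg compact_imp_closed[OF assms(2)] by (simp add: closed_vimage)
  moreover have "bounded (g -` F)"
  proof -
    obtain e where e: "\<And>y. y \<in> F \<Longrightarrow> dist (g 0) y \<le> e"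
      using compact_imp_bounded[OF assms(2)] by (auto simp: bounded_any_center[where a="g 0"])
    then have "dist 0 p \<le> e" if "p \<in> g -` F" for p
      using that dg[of 0 p] by (metis vimage_eq)
    then show ?thesis unfolding bounded_def by blast
  qed
  ultimately have "g -` F \<in> lmeasurable"
    by (simp add: compact_eq_bounded_closed lmeasurable_compact)
  then have "measure lebesgue (f -` F) = measure lebesgue (g -` F)"
    using measure_orthogonal_image[OF L] by (simp add: im measure_translation)
  then show ?thesis by (simp add: planar_area_def g_def)
qed

definition outer_unit_normal :: "(real^3) set \<Rightarrow> (real^3) set \<Rightarrow> real^3 \<Rightarrow> bool" where
  "outer_unit_normal P F u \<longleftrightarrow> norm u = 1 \<and> F = {y \<in> P. u \<bullet> y = support_function P u}"

definition minkowski_polytope :: "(real^3) set \<Rightarrow> (real^3) set \<Rightarrow> bool" where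
  "minkowski_polytope X P \<longleftrightarrow>
     polytope P \<and> aff_dim P = 3 \<and>
     card {F. F facet_of P} = card X \<and>
     {u. \<exists>F. F facet_of P \<and> outer_unit_normal P F u} = X \<and>
     (\<forall>F. F facet_of P \<longrightarrow> planar_area F = 4 * pi / real (card X))"

definition steiner_point :: "(real^3) set \<Rightarrow> real^3" where
  "steiner_point P = 3 *\<^sub>R (LINT u|sphere_measure. support_function P u *\<^sub>R u)"

definition steiner_minkowski_polytope :: "(real^3) set \<Rightarrow> (real^3) set \<Rightarrow> bool" where
  "steiner_minkowski_polytope X P \<longleftrightarrow> minkowski_polytope X P \<and> steiner_point P = 0"

definition hausdorff_dist :: "(real^3) set \<Rightarrow> (real^3) set \<Rightarrow> real" where
  "hausdorff_dist S T = max (SUP x\<in>S. infdist x T) (SUP y\<in>T. infdist y S)"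

text \<open>
  A tensor of order \<open>m\<close> over \<open>\<real>\<^sup>3\<close> is given by its coordinates, indexed by the lists
  of length \<open>m\<close> over the coordinate indices; coordinates at lists of other lengths are not part
  of the tensor.
\<close>

type_synonym tensor = "3 list \<Rightarrow> real"

definition tensor_power :: "nat \<Rightarrow> real^3 \<Rightarrow> tensor" where
  "tensor_power m v = (\<lambda>I. if length I = m then (\<Prod>i\<leftarrow>I. v $ i) else 0)"

definition hs_norm :: "nat \<Rightarrow> tensor \<Rightarrow> real" where
  "hs_norm m T = sqrt (\<Sum>I | length I = m. (T I)\<^sup>2)"

lemma finite_tensor_indices: "finite {I :: 3 list. length I = m}"
  using finite_lists_length_eq[of "UNIV :: 3 set" m] by simp

text \<open>
  The moment of the polar body of \<open>P\<close>: the points \<open>x / h\<^sub>P(x)\<close>, \<open>x \<in> X\<close>, are its vertices when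
  \<open>P\<close> is the Steiner-normalized Minkowski polytope of \<open>X\<close>.
\<close>

definition polar_vertex_moment :: "nat \<Rightarrow> (real^3) set \<Rightarrow> (real^3) set \<Rightarrow> tensor" where
  "polar_vertex_moment m X P =
     (\<lambda>I. (\<Sum>x\<in>X. tensor_power m (x /\<^sub>R support_function P x) I) / real (card X))"

definition sphere_moment :: "nat \<Rightarrow> tensor" where
  "sphere_moment m = (\<lambda>I. LINT u|sphere_measure. tensor_power m u I)"

end

theory Submission
  imports Defs
begin

text \<open>
  For \<open>m \<le> t\<close> the entries of \<open>u\<^sup>\<otimes>\<^sup>m\<close> are polynomials of degree at most \<open>t\<close>, so the
  design property turns the error tensor into the average over \<open>x \<in> X\<close> of
  \<open>(h(x)\<^sup>-\<^sup>m - 1) x\<^sup>\<otimes>\<^sup>m\<close>, whose norm is at most the largest value of \<open>\<bar>h(x)\<^sup>-\<^sup>m - 1\<bar>\<close>.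
  On the unit sphere \<open>h\<close> differs from 1 by at most the Hausdorff distance \<open>d\<close> between
  \<open>P\<close> and the ball, so this is at most \<open>4 m d\<close> once \<open>2 m d \<le> 1\<close>.
\<close>

section \<open>Hilbert-Schmidt norms of tensors\<close>

text \<open>Distributivity: a list of length \<open>m\<close> records which summand is taken from
  each of the \<open>m\<close> factors.\<close>

lemma sum_lists_length_prod_list:
  fixes f :: "'a::finite \<Rightarrow> 'b::comm_semiring_1"
  shows "(\<Sum>I | length I = m. \<Prod>i\<leftarrow>I. f i) = (\<Sum>i\<in>UNIV. f i) ^ m"
proof (induction m)
  case 0
  have "{I :: 'a list. length I = 0} = {[]}" by auto
  then show ?case by simp
next
  case (Suc m)
  have eq: "{I :: 'a list. length I = Suc m} = (\<lambda>(i, I). i # I) ` (UNIV \<times> {I. length I = m})"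
    by (auto simp: length_Suc_conv image_iff)
  have "(\<Sum>I | length I = Suc m. \<Prod>i\<leftarrow>I. f i)
      = (\<Sum>(i, I)\<in>UNIV \<times> {I. length I = m}. f i * (\<Prod>j\<leftarrow>I. f j))"
    unfolding eq by (subst sum.reindex) (auto simp: inj_on_def case_prod_unfold)
  also have "\<dots> = (\<Sum>i\<in>UNIV. f i) * (\<Sum>I | length I = m. \<Prod>i\<leftarrow>I. f i)"
    by (simp add: sum_product sum.cartesian_product)
  finally show ?case using Suc by simp
qed

lemma prod_list_square:
  fixes f :: "'a \<Rightarrow> 'b::comm_semiring_1"
  shows "(\<Prod>i\<leftarrow>I. f i)\<^sup>2 = (\<Prod>i\<leftarrow>I. (f i)\<^sup>2)"
  by (induction I) (auto simp: power_mult_distrib)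

lemma hs_norm_eq_L2_set: "hs_norm m T = L2_set T {I. length I = m}"
  by (simp add: hs_norm_def L2_set_def)

lemma hs_norm_nonneg: "0 \<le> hs_norm m T"
  by (simp add: hs_norm_eq_L2_set)

lemma hs_norm_sum_le:
  assumes "finite A"
  shows "hs_norm m (\<lambda>I. \<Sum>x\<in>A. T x I) \<le> (\<Sum>x\<in>A. hs_norm m (T x))"
  using assms
proof (induction A rule: finite_induct)
  case (insert x A)
  have "hs_norm m (\<lambda>I. \<Sum>x\<in>insert x A. T x I) = hs_norm m (\<lambda>I. T x I + (\<Sum>x\<in>A. T x I))"
    using insert by simp
  also have "\<dots> \<le> hs_norm m (T x) + hs_norm m (\<lambda>I. \<Sum>x\<in>A. T x I)"
    unfolding hs_norm_eq_L2_set by (rule L2_set_triangle_ineq)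
  finally show ?case using insert by simp
qed (simp add: hs_norm_def)

lemma hs_norm_scale: "hs_norm m (\<lambda>I. c * T I) = \<bar>c\<bar> * hs_norm m T"
  unfolding hs_norm_def
  by (simp add: power_mult_distrib real_sqrt_mult flip: sum_distrib_left)

text \<open>The squared entries are the terms in the expansion of the \<open>m\<close>-th power of
  the squared norm of \<open>v\<close>. In particular unit vectors have tensor powers of norm 1 in
  every order, so no constant growing with \<open>m\<close> enters here.\<close>

lemma hs_norm_tensor_power: "hs_norm m (tensor_power m v) = norm v ^ m"
proof -
  have "(\<Sum>I | length I = m. (tensor_power m v I)\<^sup>2) = (\<Sum>I | length I = m. \<Prod>i\<leftarrow>I. (v $ i)\<^sup>2)"
    by (simp add: tensor_power_def prod_list_square)
  also have "\<dots> = ((norm v)\<^sup>2) ^ m"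
    by (simp add: sum_lists_length_prod_list norm_vec_def L2_set_def sum_nonneg)
  also have "\<dots> = (norm v ^ m)\<^sup>2"
    by (simp add: power_mult[symmetric] mult.commute)
  finally show ?thesis by (simp add: hs_norm_def)
qed

lemma tensor_power_scaleR: "tensor_power m (c *\<^sub>R v) I = c ^ m * tensor_power m v I"
proof -
  have "(\<Prod>i\<leftarrow>I. c * v $ i) = c ^ length I * (\<Prod>i\<leftarrow>I. v $ i)"
    by (induction I) auto
  then show ?thesis unfolding tensor_power_def vector_scaleR_component real_scaleR_def by simp
qed

section \<open>Tensor entries as polynomials\<close>

text \<open>Passes from index lists to exponent vectors: by commutativity only the multiplicities in
  \<open>I\<close> matter.\<close>

lemma prod_list_eq_prod_count_list:
  fixes f :: "'a::finite \<Rightarrow> 'b::comm_monoid_mult"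
  shows "(\<Prod>i\<leftarrow>I. f i) = (\<Prod>i\<in>UNIV. f i ^ count_list I i)"
proof (induction I)
  case (Cons a I)
  have "(\<Prod>i\<in>UNIV. f i ^ count_list (a # I) i)
      = (\<Prod>i\<in>UNIV. (if i = a then f i else 1) * f i ^ count_list I i)"
    by (rule prod.cong) auto
  also have "\<dots> = f a * (\<Prod>i\<in>UNIV. f i ^ count_list I i)"
    by (simp add: prod.distrib prod.delta)
  finally show ?case using Cons by simp
qed simp

text \<open>The entry at \<open>I\<close> is a single monomial with exponent vector
  \<open>count_list I\<close> and total degree \<open>length I\<close>, or zero by convention if
  \<open>I\<close> has the wrong length.\<close>

lemma polynomial_of_degree_le_tensor_power:
  assumes "m \<le> t"
  shows "polynomial_of_degree_le t (\<lambda>u. tensor_power m u I)"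
proof (cases "length I = m")
  case True
  have "(\<Sum>i\<in>UNIV. count_list I i) = length I"
    by (simp add: sum_count_set)
  then have mem: "count_list I \<in> {\<alpha>. (\<Sum>i\<in>UNIV. \<alpha> i) \<le> t}"
    using True assms by simp
  show ?thesis
    unfolding polynomial_of_degree_le_def
  proof (intro exI[of _ "\<lambda>\<alpha>. if \<alpha> = count_list I then 1 else 0"] ext)
    fix u :: "real^3"
    have "(\<Sum>\<alpha> | (\<Sum>i\<in>UNIV. \<alpha> i) \<le> t.
          (if \<alpha> = count_list I then 1 else 0) * (\<Prod>i\<in>UNIV. (u $ i) ^ \<alpha> i))
        = (\<Sum>\<alpha> | (\<Sum>i\<in>UNIV. \<alpha> i) \<le> t.
          if \<alpha> = count_list I then \<Prod>i\<in>UNIV. (u $ i) ^ \<alpha> i else 0)"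
      by (rule sum.cong) auto
    also have "\<dots> = (\<Prod>i\<in>UNIV. (u $ i) ^ count_list I i)"
      using mem by (subst sum.delta[OF finite_multiindices]) simp
    finally show "tensor_power m u I = (\<Sum>\<alpha> | (\<Sum>i\<in>UNIV. \<alpha> i) \<le> t.
          (if \<alpha> = count_list I then 1 else 0) * (\<Prod>i\<in>UNIV. (u $ i) ^ \<alpha> i))"
      using True by (simp add: tensor_power_def prod_list_eq_prod_count_list)
  qed
next
  case False
  then show ?thesis
    unfolding polynomial_of_degree_le_def tensor_power_def
    by (intro exI[of _ "\<lambda>_. 0"]) auto
qed

section \<open>Hausdorff distance and support function\<close>

text \<open>A real \<open>SUP\<close> is sure to bound its members only if they are bounded above;
  compactness and continuity of \<open>infdist\<close> ensure this.\<close>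

lemma infdist_le_hausdorff_dist:
  assumes "compact S" "compact T"
  shows "x \<in> S \<Longrightarrow> infdist x T \<le> hausdorff_dist S T"
    and "y \<in> T \<Longrightarrow> infdist y S \<le> hausdorff_dist S T"
proof -
  have bdd: "bdd_above ((\<lambda>x. infdist x B) ` A)" if "compact A" for A B :: "(real^3) set"
    using that
    by (intro bounded_imp_bdd_above compact_imp_bounded compact_continuous_image
        continuous_on_infdist continuous_on_id)
  show "infdist x T \<le> hausdorff_dist S T" if "x \<in> S"
    using cSUP_upper[OF that bdd[OF assms(1)]] by (simp add: hausdorff_dist_def le_max_iff_disj)
  show "infdist y S \<le> hausdorff_dist S T" if "y \<in> T"
    using cSUP_upper[OF that bdd[OF assms(2)]] by (simp add: hausdorff_dist_def le_max_iff_disj)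
qed

text \<open>From above: each point of \<open>P\<close> is within the Hausdorff distance of a point
  of the ball, whose inner product with \<open>u\<close> is at most 1. From below: \<open>u\<close>
  itself lies in the ball, so \<open>P\<close> has a point that close to \<open>u\<close>.\<close>

lemma support_function_near_one:
  assumes P: "compact P" "P \<noteq> {}" and u: "norm u = 1"
  shows "\<bar>support_function P u - 1\<bar> \<le> hausdorff_dist P (cball 0 1)"
proof -
  let ?d = "hausdorff_dist P (cball 0 1)"
  have upper: "u \<bullet> y \<le> 1 + ?d" if y: "y \<in> P" for y
  proof -
    obtain b where b: "b \<in> cball 0 1" "infdist y (cball 0 1) = dist y b"
      using infdist_attains_inf[of "cball 0 1" y] by auto
    have "u \<bullet> y = u \<bullet> b + u \<bullet> (y - b)" by (simp add: inner_diff_right)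
    also have "\<dots> \<le> 1 + dist y b"
      using norm_cauchy_schwarz[of u b] norm_cauchy_schwarz[of u "y - b"] b u
      by (simp add: dist_norm)
    also have "dist y b \<le> ?d"
      using infdist_le_hausdorff_dist(1)[OF P(1) compact_cball y, of 0 1] b by simp
    finally show ?thesis by simp
  qed
  have "support_function P u \<le> 1 + ?d"
    unfolding support_function_def using P(2) upper by (rule cSUP_least)
  moreover have "1 - ?d \<le> support_function P u"
  proof -
    obtain y where y: "y \<in> P" "infdist u P = dist u y"
      using infdist_attains_inf[OF compact_imp_closed[OF P(1)] P(2)] by auto
    have "dist u y \<le> ?d"
      using infdist_le_hausdorff_dist(2)[OF P(1) compact_cball, of u 0 1] u y by simp
    moreover have "u \<bullet> y = 1 - u \<bullet> (u - y)"
      using u by (simp add: inner_diff_right dot_square_norm)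
    moreover have "u \<bullet> (u - y) \<le> dist u y"
      using norm_cauchy_schwarz[of u "u - y"] u by (simp add: dist_norm)
    \<comment> \<open>Here \<open>upper\<close> supplies the boundedness that the \<open>SUP\<close>
      requires.\<close>
    moreover have "u \<bullet> y \<le> support_function P u"
      unfolding support_function_def
      using y(1) upper by (intro cSUP_upper bdd_aboveI2) auto
    ultimately show ?thesis by linarith
  qed
  ultimately show ?thesis by linarith
qed

section \<open>Elementary estimates\<close>

text \<open>With \<open>x = real m * e\<close>, the upper bound runs through
  \<open>exp x \<le> 1 + x + x^2\<close>, and the lower one is Bernoulli's inequality. For
  \<open>m = 0\<close> the third hypothesis says nothing about \<open>e\<close>, so
  \<open>e \<le> 1\<close>, which keeps \<open>1 - e\<close> nonnegative, is a separate one.\<close>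

lemma abs_power_minus_one_le:
  fixes a e :: real
  assumes "\<bar>a - 1\<bar> \<le> e" "e \<le> 1" "real m * e \<le> 1"
  shows "\<bar>a ^ m - 1\<bar> \<le> 2 * (real m * e)"
proof -
  let ?x = "real m * e"
  have e: "0 \<le> e" and x: "0 \<le> ?x" using assms(1) by auto
  have "a ^ m \<le> exp e ^ m"
    using assms exp_ge_add_one_self[of e] by (intro power_mono) linarith+
  also have "\<dots> = exp ?x" by (simp add: exp_of_nat_mult)
  also have "\<dots> \<le> 1 + ?x + ?x\<^sup>2" using x assms(3) by (rule exp_bound)
  also have "?x\<^sup>2 \<le> ?x" using x assms(3) by (simp add: power2_eq_square mult_left_le)
  finally have "a ^ m \<le> 1 + 2 * ?x" by linarith
  moreover have "1 - ?x \<le> (1 - e) ^ m"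
    using Bernoulli_inequality[of "- e" m] assms(2) by simp
  moreover have "(1 - e) ^ m \<le> a ^ m"
    using assms by (intro power_mono) linarith+
  ultimately show ?thesis using x by linarith
qed

text \<open>The bound on \<open>d\<close> keeps \<open>h\<close> at least 1/2, so the division costs
  at most a factor 2.\<close>

lemma abs_inverse_minus_one_le:
  fixes h d :: real
  assumes "\<bar>h - 1\<bar> \<le> d" "d \<le> 1/2"
  shows "\<bar>inverse h - 1\<bar> \<le> 2 * d"
proof -
  have h: "1/2 \<le> h" using assms by linarith
  have "\<bar>inverse h - 1\<bar> = \<bar>h - 1\<bar> / h"
    using h by (simp add: field_simps abs_if)
  also have "\<dots> \<le> d / (1/2)" using h assms by (intro frac_le) linarith+
  finally show ?thesis by simp
qed

section \<open>Moment error and its limit\<close>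

text \<open>The constant 4 combines a factor 2 from inverting the support function with a factor 2
  from the \<open>m\<close>-th power.\<close>

lemma moment_error_le:
  assumes X: "spherical_design t X" and P: "compact P" "P \<noteq> {}"
    and d: "hausdorff_dist P (cball 0 1) \<le> d" "d \<le> 1/2" "2 * (real m * d) \<le> 1" and m: "m \<le> t"
  shows "hs_norm m (\<lambda>I. polar_vertex_moment m X P I - sphere_moment m I) \<le> 4 * (real m * d)"
proof -
  let ?h = "support_function P" and ?N = "real (card X)"
  let ?c = "\<lambda>x. (inverse (?h x) ^ m - 1) / ?N"
  have fin: "finite X" and N: "0 < ?N" and sph: "\<And>x. x \<in> X \<Longrightarrow> norm x = 1"
    using X by (auto simp: spherical_design_def card_gt_0_iff)
  \<comment> \<open>By the design property the sphere moment is itself an average over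
    \<open>X\<close>, so it can be subtracted point by point.\<close>
  have sm: "sphere_moment m I = (\<Sum>x\<in>X. tensor_power m x I) / ?N" for I
    using X polynomial_of_degree_le_tensor_power[OF m, of I]
    by (simp add: spherical_design_def sphere_moment_def)
  have eq: "polar_vertex_moment m X P I - sphere_moment m I
      = (\<Sum>x\<in>X. ?c x * tensor_power m x I)" for I
    by (simp add: polar_vertex_moment_def sm tensor_power_scaleR sum_divide_distrib
        diff_divide_distrib left_diff_distrib sum_subtractf)
  have c: "\<bar>?c x\<bar> \<le> 4 * (real m * d) / ?N" if x: "x \<in> X" for x
  proof -
    have "\<bar>?h x - 1\<bar> \<le> d"
      using support_function_near_one[OF P sph[OF x]] d(1) by linarith
    from abs_inverse_minus_one_le[OF this d(2)]
    \<comment> \<open>The power estimate is used with \<open>e = 2 * d\<close>; the two numerical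
      bounds on \<open>d\<close> become \<open>e \<le> 1\<close> and
      \<open>real m * e \<le> 1\<close>.\<close>
    have "\<bar>inverse (?h x) ^ m - 1\<bar> \<le> 2 * (real m * (2 * d))"
      using d by (intro abs_power_minus_one_le) auto
    then show ?thesis using N by (simp add: divide_right_mono)
  qed
  have "hs_norm m (\<lambda>I. polar_vertex_moment m X P I - sphere_moment m I)
      \<le> (\<Sum>x\<in>X. hs_norm m (\<lambda>I. ?c x * tensor_power m x I))"
    unfolding eq by (rule hs_norm_sum_le[OF fin])
  also have "\<dots> = (\<Sum>x\<in>X. \<bar>?c x\<bar>)"
    unfolding hs_norm_scale by (rule sum.cong) (simp_all add: hs_norm_tensor_power sph)
  also have "\<dots> \<le> (\<Sum>x\<in>X. 4 * (real m * d) / ?N)"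
    by (rule sum_mono) (rule c)
  also have "\<dots> = 4 * (real m * d)" using N by simp
  finally show ?thesis .
qed

text \<open>Serves both claims, since a fixed order is a constant sequence \<open>m\<close>.\<close>

lemma eventually_moment_error_le:
  fixes m :: "nat \<Rightarrow> nat"
  assumes est: "\<And>t. 2 \<le> t \<Longrightarrow> hausdorff_dist (P t) (cball 0 1) \<le> K * real t powr (-1/2)"
    and XP: "\<And>t. 2 \<le> t \<Longrightarrow> spherical_design t (X t) \<and> steiner_minkowski_polytope (X t) (P t)"
    and m: "(\<lambda>t. real (m t)) \<in> o(\<lambda>t. sqrt (real t))"
  shows "\<forall>\<^sub>F t in sequentially.
      hs_norm (m t) (\<lambda>I. polar_vertex_moment (m t) (X t) (P t) I - sphere_moment (m t) I)
        \<le> 4 * (real (m t) * (K * real t powr (-1/2)))"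
    and "(\<lambda>t. real (m t) * (K * real t powr (-1/2))) \<longlonglongrightarrow> 0"
proof -
  have eq: "real (m t) * (K * real t powr (-1/2)) = K * (real (m t) / sqrt (real t))" for t
    by (simp add: powr_minus_divide powr_half_sqrt)
  have "(\<lambda>t. real (m t) / sqrt (real t)) \<longlonglongrightarrow> 0"
    using m by (rule smalloD_tendsto)
  then show lim: "(\<lambda>t. real (m t) * (K * real t powr (-1/2))) \<longlonglongrightarrow> 0"
    unfolding eq by (rule tendsto_mult_right_zero)
  \<comment> \<open>Smallness of \<open>d\<close> does not follow from that of \<open>m * d\<close>,
    since \<open>m t\<close> may be 0.\<close>
  have "(\<lambda>t. K * real t powr (-1/2)) \<longlonglongrightarrow> 0"
    by (intro tendsto_mult_right_zero tendsto_neg_powr filterlim_real_sequentially) simp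
  then have "\<forall>\<^sub>F t in sequentially. K * real t powr (-1/2) < 1/2"
    by (rule order_tendstoD) simp
  moreover have "\<forall>\<^sub>F t in sequentially. real (m t) * (K * real t powr (-1/2)) < 1/2"
    using lim by (rule order_tendstoD) simp
  \<comment> \<open>The little-o condition with constant 1 gives \<open>m t \<le> sqrt t\<close>
    eventually, and \<open>sqrt t \<le> t\<close> for \<open>t \<ge> 1\<close>.\<close>
  moreover have "\<forall>\<^sub>F t in sequentially. m t \<le> t"
    using landau_o.smallD[OF m zero_less_one] eventually_ge_at_top[of 1]
  proof eventually_elim
    case (elim t)
    have "sqrt (real t) \<le> real t"
      using elim(2) by (intro real_le_lsqrt) (auto simp: power2_eq_square)
    then show ?case using elim(1) by simp
  qed
  ultimately show "\<forall>\<^sub>F t in sequentially.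
      hs_norm (m t) (\<lambda>I. polar_vertex_moment (m t) (X t) (P t) I - sphere_moment (m t) I)
        \<le> 4 * (real (m t) * (K * real t powr (-1/2)))"
    using eventually_ge_at_top[of 2]
  proof eventually_elim
    case (elim t)
    \<comment> \<open>Affine dimension 3 rules out the empty polytope.\<close>
    have "compact (P t)" "P t \<noteq> {}"
      using XP[OF elim(4)]
      by (auto simp: steiner_minkowski_polytope_def minkowski_polytope_def polytope_imp_compact)
    then show ?case
      using XP[OF elim(4)] est[OF elim(4)] elim by (intro moment_error_le) auto
  qed
qed

theorem corollary3p4:
  fixes K :: real
  assumes hausdorff_estimate:
    "\<And>(t::nat) X P. 2 \<le> t \<Longrightarrow> spherical_design t X \<Longrightarrow> steiner_minkowski_polytope X P \<Longrightarrow>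
       hausdorff_dist P (cball 0 1) \<le> K * real t powr (-1/2)"
  shows
    "(\<forall>m::nat. \<exists>C::real. \<forall>(X :: nat \<Rightarrow> (real^3) set) (P :: nat \<Rightarrow> (real^3) set).
        (\<forall>t\<ge>2. spherical_design t (X t) \<and> steiner_minkowski_polytope (X t) (P t)) \<longrightarrow>
        (\<forall>\<^sub>F t in sequentially.
           hs_norm m (\<lambda>I. polar_vertex_moment m (X t) (P t) I - sphere_moment m I)
             \<le> C * real t powr (-1/2)))
     \<and>
     (\<forall>(X :: nat \<Rightarrow> (real^3) set) (P :: nat \<Rightarrow> (real^3) set) (m :: nat \<Rightarrow> nat).
        (\<forall>t\<ge>2. spherical_design t (X t) \<and> steiner_minkowski_polytope (X t) (P t)) \<longrightarrow>
        (\<lambda>t. real (m t)) \<in> o(\<lambda>t. sqrt (real t)) \<longrightarrow>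
        (\<lambda>t. hs_norm (m t)
               (\<lambda>I. polar_vertex_moment (m t) (X t) (P t) I - sphere_moment (m t) I))
          \<longlonglongrightarrow> 0)"
proof (intro conjI allI exI impI)
  fix m :: nat and X P
  assume XP: "\<forall>t\<ge>2. spherical_design t (X t) \<and> steiner_minkowski_polytope (X t) (P t)"
  have "(\<lambda>t. real m) \<in> o(\<lambda>t. sqrt (real t))"
  proof (rule smalloI_tendsto)
    show "(\<lambda>t. real m / sqrt (real t)) \<longlonglongrightarrow> 0"
      by (intro real_tendsto_divide_at_top[OF tendsto_const] filterlim_at_top_imp_at_infinity
          filterlim_compose[OF sqrt_at_top] filterlim_real_sequentially)
    show "\<forall>\<^sub>F t in sequentially. sqrt (real t) \<noteq> 0"
      using eventually_gt_at_top[of 0] by eventually_elim simp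
  qed
  with XP hausdorff_estimate
  have "\<forall>\<^sub>F t in sequentially.
      hs_norm m (\<lambda>I. polar_vertex_moment m (X t) (P t) I - sphere_moment m I)
        \<le> 4 * (real m * (K * real t powr (-1/2)))"
    by (intro eventually_moment_error_le(1)) auto
  \<comment> \<open>This fixes the witness for \<open>C\<close> as \<open>4 * real m * K\<close>,
    which depends on neither \<open>X\<close> nor \<open>P\<close>.\<close>
  then show "\<forall>\<^sub>F t in sequentially.
      hs_norm m (\<lambda>I. polar_vertex_moment m (X t) (P t) I - sphere_moment m I)
        \<le> 4 * real m * K * real t powr (-1/2)"
    by (simp only: mult.assoc)
next
  fix X P and m :: "nat \<Rightarrow> nat"
  assume XP: "\<forall>t\<ge>2. spherical_design t (X t) \<and> steiner_minkowski_polytope (X t) (P t)"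
    and m: "(\<lambda>t. real (m t)) \<in> o(\<lambda>t. sqrt (real t))"
  have est: "hausdorff_dist (P t) (cball 0 1) \<le> K * real t powr (-1/2)" if "2 \<le> t" for t
    using XP that hausdorff_estimate by blast
  have des: "spherical_design t (X t) \<and> steiner_minkowski_polytope (X t) (P t)" if "2 \<le> t" for t
    using XP that by blast
  note * = eventually_moment_error_le[OF est des m]
  show "(\<lambda>t. hs_norm (m t)
      (\<lambda>I. polar_vertex_moment (m t) (X t) (P t) I - sphere_moment (m t) I)) \<longlonglongrightarrow> 0"
  \<comment> \<open>The norm is squeezed between 0 and a bound that vanishes because
    \<open>m t / sqrt t\<close> does.\<close>
  proof (rule tendsto_sandwich[OF _ *(1) tendsto_const])
    show "(\<lambda>t. 4 * (real (m t) * (K * real t powr (-1/2)))) \<longlonglongrightarrow> 0"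
      using *(2) by (rule tendsto_mult_right_zero)
  qed (simp add: hs_norm_nonneg)
qed

end
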